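(* Suppose $\omega=\omega(n)\gg1$ and $p=\omega^{-1}$, and let $r=r(n)$ be a nonnegative integer. Then, for any (real) constant $c$, as $n\to\infty$, $$\mathbb{P}\big[\mathsf{max}(\mathbf{C}_{n,p})\ge r\big]\to\begin{cases}0,&\text{if } r-\frac{\log n}{\log\omega}\gg\frac1{\log\omega},\\[3pt] 1-e^{-e^{-c}},&\text{if } r=\frac{\log n+c}{\log\omega},\\[3pt] 1,&\text{if } \frac{\log n}{\log\omega}-r\gg\frac1{\log\omega}.\end{cases}$$
   Context: An $n$-composition is a sequence of $n$ nonnegative integers. For $p=p(n)\in[0,1)$ and $q=1-p$, the geometric random composition $\mathbf{C}_{n,p}$ is the random $n$-composition whose terms are independent, with $\mathbb{P}[\mathbf{C}_{n,p}(i)=j]=qp^j$ for every $j\ge0$ and $i\in\{1,\dots,n\}$. $\mathsf{max}(C)$ denotes the largest term of the composition $C$. For functions of $n$ that are positive (for large $n$): $f\gg g$ means $\lim_{n\to\infty} g/f=0$; in particular $\omega\gg1$ means $\omega(n)\to\infty$. *)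

theory Defs
  imports "HOL-Probability.Probability"
begin

(* "f >> g" compares functions that are positive for large n, so positivity is part of the
   relation.  Without it, an f tending to minus infinity would also satisfy f >> 1. *)
definition much_greater :: "(nat \<Rightarrow> real) \<Rightarrow> (nat \<Rightarrow> real) \<Rightarrow> bool"  (infix "\<ggreater>" 50)
  where "f \<ggreater> g \<longleftrightarrow>
    (\<forall>\<^sub>F n in sequentially. 0 < f n) \<and> (\<forall>\<^sub>F n in sequentially. 0 < g n) \<and>
    (\<lambda>n. g n / f n) \<longlonglongrightarrow> 0"

lemma much_greater_1_iff: "\<omega> \<ggreater> (\<lambda>_. 1) \<longleftrightarrow> filterlim \<omega> at_top sequentially"
proof
  assume "\<omega> \<ggreater> (\<lambda>_. 1)"
  then have pos: "\<forall>\<^sub>F n in sequentially. 0 < \<omega> n" and "(\<lambda>n. 1 / \<omega> n) \<longlonglongrightarrow> 0"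
    by (auto simp: much_greater_def)
  then have "filterlim (\<lambda>n. inverse (1 / \<omega> n)) at_top sequentially"
    by (intro filterlim_inverse_at_top) auto
  then show "filterlim \<omega> at_top sequentially" by simp
next
  assume lim: "filterlim \<omega> at_top sequentially"
  then have "\<forall>\<^sub>F n in sequentially. 0 < \<omega> n"
    by (simp add: filterlim_at_top_dense)
  moreover have "(\<lambda>n. 1 / \<omega> n) \<longlonglongrightarrow> 0"
    using tendsto_inverse_0_at_top[OF lim] by (simp add: inverse_eq_divide)
  ultimately show "\<omega> \<ggreater> (\<lambda>_. 1)" by (simp add: much_greater_def)
qed

(* An n-composition is a function on {1..n}, extended by 0 outside.
   geometric_pmf takes the success probability q = 1 - p as its argument. *)
definition geom_composition :: "nat \<Rightarrow> real \<Rightarrow> (nat \<Rightarrow> nat) pmf"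
  where "geom_composition n p = Pi_pmf {1..n} 0 (\<lambda>_. geometric_pmf (1 - p))"

(* Meaningful for n > 0 only: an empty composition has no largest term. *)
definition max_term :: "nat \<Rightarrow> (nat \<Rightarrow> nat) \<Rightarrow> nat"
  where "max_term n C = Max (C ` {1..n})"

lemma prob_geom_composition_term:
  assumes "0 \<le> p" "p < 1" "i \<in> {1..n}"
  shows "measure_pmf.prob (geom_composition n p) {C. C i = j} = (1 - p) * p ^ j"
proof -
  have "measure_pmf.prob (geom_composition n p) {C. C i = j} =
      measure_pmf.prob (map_pmf (\<lambda>C. C i) (geom_composition n p)) {j}"
    by (simp add: vimage_def)
  also have "map_pmf (\<lambda>C. C i) (geom_composition n p) = geometric_pmf (1 - p)"
    unfolding geom_composition_def using assms(3) by (subst Pi_pmf_component) auto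
  also have "measure_pmf.prob (geometric_pmf (1 - p)) {j} = (1 - p) * p ^ j"
    using assms by (simp add: measure_pmf_single)
  finally show ?thesis .
qed

lemma indep_vars_geom_composition:
  "prob_space.indep_vars (measure_pmf (geom_composition n p))
     (\<lambda>_. count_space UNIV) (\<lambda>i C. C i) {1..n}"
  unfolding geom_composition_def by (rule indep_vars_Pi_pmf) simp

end

theory Submission
  imports Defs
begin

text \<open>
  The $n$ terms of the composition are independent and each is at least $r$ with probability $p^r$,
  so the maximum is at least $r$ with probability $1 - (1 - p^r)^n$.  Everything is therefore decided
  by the expected number $n p^r$ of terms that are at least $r$.  Since $p = 1/\omega$,
  \[ n p^r = \exp (\log n - r \log \omega)
       = \exp \Bigl(-\Bigl(r - \frac{\log n}{\log \omega}\Bigr) \log \omega\Bigr), \]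
  so the three hypotheses on $r$ say that $n p^r$ tends to $0$, equals $e^{-c}$ for large $n$,
  and tends to infinity.  In the middle case $(1 - p^r)^n = (1 - e^{-c}/n)^n \to e^{-e^{-c}}$.
  In the other two cases Bernoulli's inequality and convexity of the exponential function,
  $1 - nx \le (1 - x)^n \le e^{-nx}$ with $x = p^r$, give the limits $1$ and $0$ of $(1 - p^r)^n$.
\<close>

lemma prob_geometric_pmf_lessThan:
  assumes "0 \<le> p" "p < 1"
  shows "measure_pmf.prob (geometric_pmf (1 - p)) {..<r} = 1 - p ^ r"
proof -
  have "measure_pmf.prob (geometric_pmf (1 - p)) {..<r} = (1 - p) * (\<Sum>j<r. p ^ j)"
    using assms by (simp add: measure_measure_pmf_finite sum_distrib_left mult.commute)
  then show ?thesis
    by (simp add: one_diff_power_eq)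
qed

text \<open>The complementary event is a product event, so independence turns it into a power.\<close>

lemma prob_max_term_ge:
  assumes "0 \<le> p" "p < 1" "n > 0"
  shows "measure_pmf.prob (geom_composition n p) {C. max_term n C \<ge> r} = 1 - (1 - p ^ r) ^ n"
proof -
  have "{C. max_term n C \<ge> r} = UNIV - Pi {1..n} (\<lambda>_. {..<r})"
    using assms(3) by (auto simp: max_term_def Max_ge_iff Pi_def not_less)
  then have "measure_pmf.prob (geom_composition n p) {C. max_term n C \<ge> r} =
      1 - measure_pmf.prob (geom_composition n p) (Pi {1..n} (\<lambda>_. {..<r}))"
    using measure_pmf.prob_compl[of "Pi {1..n} (\<lambda>_. {..<r})" "geom_composition n p"] by simp
  also have "\<dots> = 1 - (1 - p ^ r) ^ n"
    unfolding geom_composition_def using assms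
    by (simp add: measure_Pi_pmf_Pi prob_geometric_pmf_lessThan)
  finally show ?thesis .
qed

lemma tendsto_one_minus_power_0:
  fixes x :: "nat \<Rightarrow> real"
  assumes "\<forall>\<^sub>F n in sequentially. x n \<le> 1"
    and "filterlim (\<lambda>n. real n * x n) at_top sequentially"
  shows "(\<lambda>n. (1 - x n) ^ n) \<longlonglongrightarrow> 0"
proof (rule tendsto_sandwich[OF _ _ tendsto_const])
  show "\<forall>\<^sub>F n in sequentially. 0 \<le> (1 - x n) ^ n"
    using assms(1) by eventually_elim simp
  show "\<forall>\<^sub>F n in sequentially. (1 - x n) ^ n \<le> exp (- (real n * x n))"
    using assms(1)
  proof eventually_elim
    case (elim n)
    have "(1 - x n) ^ n \<le> exp (- x n) ^ n"
      using elim exp_ge_add_one_self[of "- x n"] by (intro power_mono) auto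
    then show ?case
      by (simp add: exp_of_nat_mult[symmetric])
  qed
  show "(\<lambda>n. exp (- (real n * x n))) \<longlonglongrightarrow> 0"
    using assms(2)
    by (intro filterlim_compose[OF exp_at_bot]) (simp add: filterlim_uminus_at_bot)
qed

lemma tendsto_one_minus_power_1:
  fixes x :: "nat \<Rightarrow> real"
  assumes "\<forall>\<^sub>F n in sequentially. 0 \<le> x n \<and> x n \<le> 1"
    and "(\<lambda>n. real n * x n) \<longlonglongrightarrow> 0"
  shows "(\<lambda>n. (1 - x n) ^ n) \<longlonglongrightarrow> 1"
proof (rule tendsto_sandwich[OF _ _ _ tendsto_const])
  show "\<forall>\<^sub>F n in sequentially. 1 - real n * x n \<le> (1 - x n) ^ n"
    using assms(1)
  proof eventually_elim
    case (elim n)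
    then show ?case
      using Bernoulli_inequality[of "- x n" n] by simp
  qed
  show "\<forall>\<^sub>F n in sequentially. (1 - x n) ^ n \<le> 1"
    using assms(1) by eventually_elim (simp add: power_le_one)
  show "(\<lambda>n. 1 - real n * x n) \<longlonglongrightarrow> 1"
    using tendsto_diff[OF tendsto_const assms(2), of 1] by simp
qed

text \<open>Deviations of $r$ from $\log n / \log \omega$ are measured on the scale $1 / \log \omega$
  because multiplying by $\log \omega$ turns them into the exponent of $n p^r$.\<close>

lemma much_greater_inverse_imp_mult_at_top:
  assumes "f \<ggreater> (\<lambda>n. 1 / l n)"
  shows "filterlim (\<lambda>n. f n * l n) at_top sequentially"
proof -
  have "(\<lambda>n. 1 / l n / f n) \<longlonglongrightarrow> 0" "\<forall>\<^sub>F n in sequentially. 0 < 1 / l n / f n"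
    using assms by (auto simp: much_greater_def elim: eventually_elim2)
  then have "filterlim (\<lambda>n. inverse (1 / l n / f n)) at_top sequentially"
    by (rule filterlim_inverse_at_top)
  then show ?thesis
    by (simp add: mult.commute)
qed

theorem proposition4p9:
  fixes \<omega> p :: "nat \<Rightarrow> real" and r :: "nat \<Rightarrow> nat" and c :: real
  assumes "\<omega> \<ggreater> (\<lambda>_. 1)"
    and "\<And>n. p n = 1 / \<omega> n"
  shows
    "((\<lambda>n. real (r n) - ln (real n) / ln (\<omega> n)) \<ggreater> (\<lambda>n. 1 / ln (\<omega> n)) \<longrightarrow>
        (\<lambda>n. measure_pmf.prob (geom_composition n (p n)) {C. max_term n C \<ge> r n}) \<longlonglongrightarrow> 0)
     \<and>
     ((\<forall>\<^sub>F n in sequentially. real (r n) = (ln (real n) + c) / ln (\<omega> n)) \<longrightarrow>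
        (\<lambda>n. measure_pmf.prob (geom_composition n (p n)) {C. max_term n C \<ge> r n})
          \<longlonglongrightarrow> 1 - exp (- exp (- c)))
     \<and>
     ((\<lambda>n. ln (real n) / ln (\<omega> n) - real (r n)) \<ggreater> (\<lambda>n. 1 / ln (\<omega> n)) \<longrightarrow>
        (\<lambda>n. measure_pmf.prob (geom_composition n (p n)) {C. max_term n C \<ge> r n}) \<longlonglongrightarrow> 1)"
proof -
  define x where "x n = p n ^ r n" for n
  have "filterlim \<omega> at_top sequentially"
    using assms(1) by (simp add: much_greater_1_iff)
  then have large: "\<forall>\<^sub>F n in sequentially. 1 < \<omega> n \<and> 0 < n"
    by (simp add: filterlim_at_top_dense eventually_conj eventually_gt_at_top)
  have prob: "\<forall>\<^sub>F n in sequentially. 1 - (1 - x n) ^ n =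
      measure_pmf.prob (geom_composition n (p n)) {C. max_term n C \<ge> r n}"
    using large by eventually_elim (simp add: x_def assms(2) prob_max_term_ge)
  have x_bounds: "\<forall>\<^sub>F n in sequentially. 0 \<le> x n \<and> x n \<le> 1"
    using large by eventually_elim (simp add: x_def assms(2) power_le_one)
  have mean: "\<forall>\<^sub>F n in sequentially. exp (ln (real n) - real (r n) * ln (\<omega> n)) = real n * x n"
    using large
    by eventually_elim
      (simp add: x_def assms(2) exp_diff exp_of_nat_mult power_inverse divide_inverse)
  have limI: "(\<lambda>n. measure_pmf.prob (geom_composition n (p n)) {C. max_term n C \<ge> r n})
      \<longlonglongrightarrow> 1 - L" if "(\<lambda>n. (1 - x n) ^ n) \<longlonglongrightarrow> L" for L
    using tendsto_diff[OF tendsto_const that] prob by (rule Lim_transform_eventually)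
  show ?thesis
  proof (intro conjI impI)
    assume "(\<lambda>n. real (r n) - ln (real n) / ln (\<omega> n)) \<ggreater> (\<lambda>n. 1 / ln (\<omega> n))"
    then have "filterlim (\<lambda>n. (real (r n) - ln (real n) / ln (\<omega> n)) * ln (\<omega> n))
        at_top sequentially"
      by (rule much_greater_inverse_imp_mult_at_top)
    then have "(\<lambda>n. exp (- ((real (r n) - ln (real n) / ln (\<omega> n)) * ln (\<omega> n)))) \<longlonglongrightarrow> 0"
      by (intro filterlim_compose[OF exp_at_bot]) (simp add: filterlim_uminus_at_bot)
    moreover have "\<forall>\<^sub>F n in sequentially.
        exp (- ((real (r n) - ln (real n) / ln (\<omega> n)) * ln (\<omega> n))) = real n * x n"
      using mean large by eventually_elim (simp add: left_diff_distrib)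
    ultimately have "(\<lambda>n. real n * x n) \<longlonglongrightarrow> 0"
      by (rule Lim_transform_eventually)
    then have "(\<lambda>n. (1 - x n) ^ n) \<longlonglongrightarrow> 1"
      by (rule tendsto_one_minus_power_1[OF x_bounds])
    from limI[OF this] show "(\<lambda>n. measure_pmf.prob (geom_composition n (p n))
        {C. max_term n C \<ge> r n}) \<longlonglongrightarrow> 0"
      by simp
  next
    assume "\<forall>\<^sub>F n in sequentially. real (r n) = (ln (real n) + c) / ln (\<omega> n)"
    with mean large have "\<forall>\<^sub>F n in sequentially. (1 + - exp (- c) / real n) ^ n = (1 - x n) ^ n"
    proof eventually_elim
      case (elim n)
      then have "real n * x n = exp (- c)"
        by simp
      with elim have "x n = exp (- c) / real n"
        by (simp add: field_simps)
      then show ?case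
        by simp
    qed
    with tendsto_exp_limit_sequentially have "(\<lambda>n. (1 - x n) ^ n) \<longlonglongrightarrow> exp (- exp (- c))"
      by (rule Lim_transform_eventually)
    then show "(\<lambda>n. measure_pmf.prob (geom_composition n (p n)) {C. max_term n C \<ge> r n})
        \<longlonglongrightarrow> 1 - exp (- exp (- c))"
      by (rule limI)
  next
    assume "(\<lambda>n. ln (real n) / ln (\<omega> n) - real (r n)) \<ggreater> (\<lambda>n. 1 / ln (\<omega> n))"
    then have "filterlim (\<lambda>n. (ln (real n) / ln (\<omega> n) - real (r n)) * ln (\<omega> n))
        at_top sequentially"
      by (rule much_greater_inverse_imp_mult_at_top)
    then have "filterlim (\<lambda>n. exp ((ln (real n) / ln (\<omega> n) - real (r n)) * ln (\<omega> n)))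
        at_top sequentially"
      by (rule filterlim_compose[OF exp_at_top])
    moreover have "\<forall>\<^sub>F n in sequentially.
        exp ((ln (real n) / ln (\<omega> n) - real (r n)) * ln (\<omega> n)) = real n * x n"
      using mean large by eventually_elim (simp add: left_diff_distrib)
    ultimately have "filterlim (\<lambda>n. real n * x n) at_top sequentially"
      by (simp add: filterlim_cong[OF refl refl])
    then have "(\<lambda>n. (1 - x n) ^ n) \<longlonglongrightarrow> 0"
      using x_bounds by (intro tendsto_one_minus_power_0) (auto elim: eventually_mono)
    from limI[OF this] show "(\<lambda>n. measure_pmf.prob (geom_composition n (p n))
        {C. max_term n C \<ge> r n}) \<longlonglongrightarrow> 1"
      by simp
  qed
qed

end
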